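(* Let $X\ne\{0\}$ be a complex Banach space and let $\eta:[0,\infty[\to]0,\infty[$ be a decreasing continuous function such that $\lim_{t\to\infty}t^k\eta(t)=0$ for every $k\in\mathbb N$. For $n\ge1$ let $v_n(x)=\eta(\|x\|)^{1/n}$ and $w_n(x)=\eta(\|x\|/n)$, $x\in X$, and let $V=\{v_n\}_n$, $W=\{w_n\}_n$. Then $HW(X)$ is an algebra if and only if there exist $k>1$ and $C>0$ such that $\eta(kt)\le C\,\tilde\eta(t)^2$ for all $t\ge0$. If, furthermore, $\eta$ is essential, then $HW(X)$ is an algebra if and only if there exist $k>1$ and $C>0$ such that $\eta(kt)\le C\,\eta(t)^2$ for all $t\ge0$. In this case, $HW(X)\hookrightarrow HV(X)$ continuously and there exist positive constants $a,b,\alpha$ such that $\eta(t)\le a e^{-bt^\alpha}$ for all $t\ge0$.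
   Context: For a countable family $V$ of weights on $X$ (continuous bounded functions $X\to[0,\infty[$), $HV(X)$ is the space of holomorphic $f:X\to\mathbb C$ with $\|f\|_v:=\sup_{x\in X}v(x)|f(x)|<\infty$ for all $v\in V$, endowed with the Fréchet topology given by these seminorms. $HV(X)$ is an algebra if it is closed under pointwise multiplication and multiplication is continuous, i.e. for every $v\in V$ there exist $u_1,u_2\in V$ and $C>0$ with $\|fg\|_v\le C\|f\|_{u_1}\|g\|_{u_2}$ for all $f,g\in HV(X)$; similarly for $W$. The associated weight of $\eta$ is $\tilde\eta(t)=1/\sup\{|g(t)|: g\in H(\mathbb C),\ |g(z)|\le 1/\eta(|z|)\ \text{for all }z\in\mathbb C\}$. One always has $\eta\le\tilde\eta$; $\eta$ is called essential if there is a constant $C$ with $\tilde\eta\le C\eta$. *)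

theory Defs
  imports "HOL-Complex_Analysis.Complex_Analysis"
begin

text \<open>Complex normed spaces are real normed spaces with a compatible complex scalar
  multiplication, so that the library's topology and Frechet derivatives apply to them.\<close>

class complex_normed_vector = real_normed_vector +
  fixes scaleC :: "complex \<Rightarrow> 'a \<Rightarrow> 'a" (infixr \<open>*\<^sub>C\<close> 75)
  assumes scaleC_add_right: "c *\<^sub>C (x + y) = c *\<^sub>C x + c *\<^sub>C y"
    and scaleC_add_left: "(c + d) *\<^sub>C x = c *\<^sub>C x + d *\<^sub>C x"
    and scaleC_scaleC: "c *\<^sub>C d *\<^sub>C x = (c * d) *\<^sub>C x"
    and scaleC_of_real: "complex_of_real r *\<^sub>C x = r *\<^sub>R x"
    and norm_scaleC: "norm (c *\<^sub>C x) = cmod c * norm x"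

class complex_banach = complex_normed_vector + banach

instantiation complex :: complex_banach
begin

definition scaleC_complex :: "complex \<Rightarrow> complex \<Rightarrow> complex"
  where "scaleC_complex c z = c * z"

instance
  by standard
    (simp_all add: scaleC_complex_def algebra_simps scaleR_conv_of_real norm_mult)

end

text \<open>Holomorphy on the whole space: at every point there is a complex-linear
  (bounded) Frechet derivative.\<close>

definition entire :: "('a::complex_normed_vector \<Rightarrow> complex) \<Rightarrow> bool"
  where "entire f \<longleftrightarrow>
    (\<forall>x. \<exists>D. (f has_derivative D) (at x) \<and> (\<forall>c y. D (c *\<^sub>C y) = c * D y))"

definition weighted_norm ::
    "('a \<Rightarrow> real) \<Rightarrow> ('a \<Rightarrow> complex) \<Rightarrow> real"
  where "weighted_norm v f = (SUP x. v x * cmod (f x))"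

text \<open>Finiteness of the supremum is stated separately, since \<^const>\<open>Sup\<close> on the reals is
  unspecified for unbounded sets.\<close>

definition weighted_space ::
    "('a::complex_normed_vector \<Rightarrow> real) set \<Rightarrow> ('a \<Rightarrow> complex) set"
  where "weighted_space V =
    {f. entire f \<and> (\<forall>v\<in>V. bdd_above (range (\<lambda>x. v x * cmod (f x))))}"

definition weighted_topology ::
    "('a::complex_normed_vector \<Rightarrow> real) set \<Rightarrow> ('a \<Rightarrow> complex) topology"
  where "weighted_topology V = topology_generated_by
    {{g \<in> weighted_space V. weighted_norm v (\<lambda>x. g x - f x) < r} | v f r.
      v \<in> V \<and> f \<in> weighted_space V \<and> r > 0}"

definition weighted_space_is_algebra ::
    "('a::complex_normed_vector \<Rightarrow> real) set \<Rightarrow> bool"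
  where "weighted_space_is_algebra V \<longleftrightarrow>
    (\<forall>f\<in>weighted_space V. \<forall>g\<in>weighted_space V. (\<lambda>x. f x * g x) \<in> weighted_space V) \<and>
    (\<forall>v\<in>V. \<exists>u1\<in>V. \<exists>u2\<in>V. \<exists>C>0. \<forall>f\<in>weighted_space V. \<forall>g\<in>weighted_space V.
      weighted_norm v (\<lambda>x. f x * g x) \<le> C * weighted_norm u1 f * weighted_norm u2 g)"

text \<open>Functions \<open>\<eta>\<close> on the half-line are total functions on the reals, and only their values
  on \<open>{0..}\<close> are relevant.\<close>

definition associated_weight :: "(real \<Rightarrow> real) \<Rightarrow> real \<Rightarrow> real"
  where "associated_weight \<eta> t =
    1 / Sup {cmod (g (complex_of_real t)) | g.
      g holomorphic_on UNIV \<and> (\<forall>z. cmod (g z) \<le> 1 / \<eta> (cmod z))}"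

definition essential :: "(real \<Rightarrow> real) \<Rightarrow> bool"
  where "essential \<eta> \<longleftrightarrow> (\<exists>C. \<forall>t\<ge>0. associated_weight \<eta> t \<le> C * \<eta> t)"

definition power_weights ::
    "(real \<Rightarrow> real) \<Rightarrow> ('a::complex_normed_vector \<Rightarrow> real) set"
  where "power_weights \<eta> = {\<lambda>x. \<eta> (norm x) powr (1 / real n) | n. n \<ge> 1}"

definition dilation_weights ::
    "(real \<Rightarrow> real) \<Rightarrow> ('a::complex_normed_vector \<Rightarrow> real) set"
  where "dilation_weights \<eta> = {\<lambda>x. \<eta> (norm x / real n) | n. n \<ge> 1}"

end

theory Submission
  imports Defs
begin

text \<open>Let \<open>\<eta>(\<parallel>x\<parallel>/m) \<bar>f x\<bar> \<le> 1\<close> on \<open>X\<close>. On each complex line through \<open>0\<close> the dilate of \<open>f\<close> by \<open>m\<close> competes in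
  the supremum defining \<open>\<eta>~\<close>, so \<open>\<bar>f x\<bar> \<le> 1 / \<eta>~(\<parallel>x\<parallel>/m)\<close>; hence the growth condition makes multiplication
  continuous. Conversely, apply continuity of multiplication to the square of \<open>p \<circ> \<phi>\<close>, where \<open>\<phi>\<close> is a
  norming functional (Hahn-Banach) and \<open>p\<close> is a dilated Taylor polynomial of an entire function \<open>g\<close>
  with \<open>\<bar>g z\<bar> \<le> 1 / \<eta> \<bar>z\<bar>\<close>: such functions lie in the space because \<open>\<eta>\<close> decreases rapidly, and the
  constants lost by truncating \<open>g\<close> are absorbed in \<open>k\<close> and \<open>C\<close>. In the essential case, iterating
  \<open>\<eta> (k t) \<le> C (\<eta> t)\<^sup>2\<close> gives both the embedding and the decay.\<close>

section \<open>Norming functionals\<close>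

text \<open>Homogeneity is asked only as an inequality for \<open>c > 0\<close>. Applying it to
  \<open>1 / c\<close> as well gives equality, and infima are then quick to check.\<close>

definition sublinear :: "('a::real_vector \<Rightarrow> real) \<Rightarrow> bool"
  where "sublinear p \<longleftrightarrow>
    (\<forall>x y. p (x + y) \<le> p x + p y) \<and> (\<forall>c>0. \<forall>x. p (c *\<^sub>R x) \<le> c * p x)"

lemma sublinear_add: "sublinear p \<Longrightarrow> p (x + y) \<le> p x + p y"
  by (simp add: sublinear_def)

lemma sublinear_scaleR:
  assumes "sublinear p" "c > 0"
  shows "p (c *\<^sub>R x) = c * p x"
proof (rule antisym)
  show "p (c *\<^sub>R x) \<le> c * p x"
    using assms by (simp add: sublinear_def)
  have "p ((1 / c) *\<^sub>R c *\<^sub>R x) \<le> (1 / c) * p (c *\<^sub>R x)"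
    using assms unfolding sublinear_def by (meson zero_less_divide_1_iff)
  then show "c * p x \<le> p (c *\<^sub>R x)"
    using assms(2) by (simp add: field_simps)
qed

lemma sublinear_0:
  assumes "sublinear p"
  shows "p 0 = 0"
  using sublinear_scaleR[OF assms, of 2 0] by simp

lemma sublinear_scaleR_nonneg:
  assumes "sublinear p" "c \<ge> 0"
  shows "p (c *\<^sub>R x) = c * p x"
  using assms by (cases "c = 0") (simp_all add: sublinear_0 sublinear_scaleR)

lemma sublinear_minus: "sublinear p \<Longrightarrow> - p (- x) \<le> p x"
  using sublinear_add[of p x "- x"] sublinear_0[of p] by simp

lemma sublinear_norm: "sublinear norm"
  by (simp add: sublinear_def norm_triangle_ineq)

text \<open>The infimum over \<open>s \<ge> 0\<close> of
  \<open>p (x + s *\<^sub>R a) - s * p a\<close> is finite, as subadditivity bounds each term below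
  by \<open>- p (- x)\<close>. The values \<open>s = 0\<close> and \<open>s = 1\<close> give the two
  upper bounds.\<close>

lemma sublinear_shear:
  fixes p :: "'a::real_vector \<Rightarrow> real"
  assumes p: "sublinear p"
  obtains q where "sublinear q" "q \<le> p" "\<And>x. q x \<le> p (x + a) - p a"
proof -
  define h where "h x s = p (x + s *\<^sub>R a) - s * p a" for x and s :: real
  define q where "q x = (INF s\<in>{0..}. h x s)" for x
  have lower: "- p (- x) \<le> h x s" if "s \<ge> 0" for x s
    using sublinear_add[OF p, of "x + s *\<^sub>R a" "- x"] sublinear_scaleR_nonneg[OF p that, of a]
    by (simp add: h_def)
  then have bdd: "bdd_below (h x ` {0..})" for x
    by (auto intro!: bdd_belowI2[where m = "- p (- x)"])
  have q_le: "q x \<le> h x s" if "s \<ge> 0" for x s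
    unfolding q_def by (rule cINF_lower[OF bdd]) (use that in simp)
  have le_q: "c \<le> q x" if "\<And>s. s \<ge> 0 \<Longrightarrow> c \<le> h x s" for c x
    unfolding q_def by (rule cINF_greatest) (use that in auto)
  have add: "q (x + y) \<le> q x + q y" for x y
  proof -
    have "q (x + y) \<le> h x s + h y t" if "s \<ge> 0" "t \<ge> 0" for s t
    proof -
      have "q (x + y) \<le> h (x + y) (s + t)"
        using that by (intro q_le) simp
      also have "\<dots> \<le> h x s + h y t"
        using sublinear_add[OF p, of "x + s *\<^sub>R a" "y + t *\<^sub>R a"]
        by (simp add: h_def algebra_simps)
      finally show ?thesis .
    qed
    then have "q (x + y) - h x s \<le> q y" if "s \<ge> 0" for s
      using that by (intro le_q) (simp add: algebra_simps)
    then have "q (x + y) - q y \<le> q x"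
      by (intro le_q) (simp add: algebra_simps)
    then show ?thesis by simp
  qed
  have scale: "q (c *\<^sub>R x) \<le> c * q x" if "c > 0" for c x
  proof -
    have "q (c *\<^sub>R x) / c \<le> h x s" if "s \<ge> 0" for s
    proof -
      have "q (c *\<^sub>R x) \<le> h (c *\<^sub>R x) (c * s)"
        using that \<open>c > 0\<close> by (intro q_le) simp
      also have "\<dots> = c * h x s"
        using sublinear_scaleR[OF p \<open>c > 0\<close>, of "x + s *\<^sub>R a"]
        by (simp add: h_def algebra_simps)
      finally show ?thesis
        using \<open>c > 0\<close> by (simp add: field_simps)
    qed
    then have "q (c *\<^sub>R x) / c \<le> q x"
      by (rule le_q)
    then show ?thesis
      using \<open>c > 0\<close> by (simp add: field_simps)
  qed
  show thesis
  proof
    show "sublinear q"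
      using add scale by (simp add: sublinear_def)
    show "q \<le> p"
      using q_le[of 0] by (simp add: le_fun_def h_def)
    show "q x \<le> p (x + a) - p a" for x
      using q_le[of 1 x] by (simp add: h_def)
  qed
qed

text \<open>Zorn's lemma for the reversed pointwise order. A nonempty chain is bounded below
  pointwise by \<open>- p (- x)\<close>, and its infimum is sublinear.\<close>

lemma sublinear_minimal:
  fixes p :: "'a::real_vector \<Rightarrow> real"
  assumes p: "sublinear p"
  obtains m where "sublinear m" "m \<le> p" "\<And>q. sublinear q \<Longrightarrow> q \<le> m \<Longrightarrow> q = m"
proof -
  let ?A = "{q. sublinear q \<and> q \<le> p}"
  let ?r = "relation_of (\<ge>) ?A"
  have "\<exists>m\<in>?A. \<forall>q\<in>?A. m \<ge> q \<longrightarrow> q = m"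
  proof (rule predicate_Zorn)
    show "partial_order_on ?A ?r"
      by (rule partial_order_on_relation_ofI) auto
  next
    fix C assume "C \<in> Chains ?r"
    then have C: "\<And>q. q \<in> C \<Longrightarrow> sublinear q" "\<And>q. q \<in> C \<Longrightarrow> q \<le> p"
      and chain: "\<And>q r. q \<in> C \<Longrightarrow> r \<in> C \<Longrightarrow> q \<le> r \<or> r \<le> q"
      by (auto simp: Chains_def relation_of_def)
    show "\<exists>u\<in>?A. \<forall>q\<in>C. q \<ge> u"
    proof (cases "C = {}")
      case True
      then show ?thesis using p by auto
    next
      case False
      define u where "u x = (INF q\<in>C. q x)" for x
      have lower: "- p (- x) \<le> q x" if "q \<in> C" for q x
        using sublinear_minus[OF C(1)[OF that], of x] le_funD[OF C(2)[OF that], of "- x"] by simp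
      then have bdd: "bdd_below ((\<lambda>q. q x) ` C)" for x
        by (auto intro!: bdd_belowI2[where m = "- p (- x)"])
      have u_le: "u x \<le> q x" if "q \<in> C" for x q
        unfolding u_def by (rule cINF_lower[OF bdd that])
      have le_u: "c \<le> u x" if "\<And>q. q \<in> C \<Longrightarrow> c \<le> q x" for c x
        unfolding u_def by (rule cINF_greatest[OF False that])
      have "u (x + y) \<le> u x + u y" for x y
      proof -
        \<comment> \<open>Two members of the chain have a common lower one, to which subadditivity
          applies; afterwards the infima over \<open>q\<close> and \<open>r\<close> can be taken
          separately.\<close>
        have *: "u (x + y) \<le> q x + r y" if "q \<in> C" "r \<in> C" for q r
        proof -
          obtain s where s: "s \<in> C" "s \<le> q" "s \<le> r"
            using chain[OF \<open>q \<in> C\<close> \<open>r \<in> C\<close>] \<open>q \<in> C\<close> \<open>r \<in> C\<close> by auto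
          have "u (x + y) \<le> s (x + y)"
            by (rule u_le[OF s(1)])
          also have "\<dots> \<le> s x + s y"
            by (rule sublinear_add[OF C(1)[OF s(1)]])
          also have "\<dots> \<le> q x + r y"
            by (intro add_mono le_funD[OF s(2)] le_funD[OF s(3)])
          finally show ?thesis .
        qed
        have "u (x + y) - q x \<le> u y" if "q \<in> C" for q
        proof (rule le_u)
          show "u (x + y) - q x \<le> r y" if "r \<in> C" for r
            using *[OF \<open>q \<in> C\<close> that] by simp
        qed
        then have "u (x + y) - u y \<le> u x"
          by (intro le_u) (simp add: algebra_simps)
        then show ?thesis by simp
      qed
      moreover have "u (c *\<^sub>R x) \<le> c * u x" if "c > 0" for c x
      proof -
        have "u (c *\<^sub>R x) / c \<le> q x" if "q \<in> C" for q
          using u_le[OF that, of "c *\<^sub>R x"] sublinear_scaleR[OF C(1)[OF that] \<open>c > 0\<close>, of x] \<open>c > 0\<close>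
          by (simp add: field_simps)
        then have "u (c *\<^sub>R x) / c \<le> u x"
          by (rule le_u)
        then show ?thesis
          using \<open>c > 0\<close> by (simp add: field_simps)
      qed
      ultimately have "sublinear u"
        by (simp add: sublinear_def)
      moreover obtain q where "q \<in> C" using False by auto
      then have "u \<le> p"
        by (intro le_funI order_trans[OF u_le le_funD[OF C(2)]])
      ultimately show ?thesis
        using u_le by (auto simp: le_fun_def)
    qed
  qed
  then obtain m where m: "sublinear m" "m \<le> p"
    "\<And>q. sublinear q \<Longrightarrow> q \<le> p \<Longrightarrow> q \<le> m \<Longrightarrow> q = m"
    by blast
  show thesis
    by (rule that[OF m(1,2)]) (use m order_trans in blast)
qed

text \<open>A minimal sublinear functional is linear, because shearing cannot decrease it.\<close>

lemma linear_below_sublinear: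
  fixes p :: "'a::real_vector \<Rightarrow> real"
  assumes "sublinear p"
  obtains f where "linear f" "f \<le> p"
proof -
  obtain m where m: "sublinear m" "m \<le> p" "\<And>q. sublinear q \<Longrightarrow> q \<le> m \<Longrightarrow> q = m"
    using sublinear_minimal[OF assms] by blast
  have add: "m (x + a) = m x + m a" for x a
  proof (rule antisym[OF sublinear_add[OF m(1)]])
    obtain q where q: "sublinear q" "q \<le> m" "\<And>x. q x \<le> m (x + a) - m a"
      using sublinear_shear[OF m(1)] by blast
    have "q = m" by (rule m(3)[OF q(1,2)])
    with q(3)[of x] show "m x + m a \<le> m (x + a)"
      by simp
  qed
  have minus: "m (- x) = - m x" for x
    using add[of x "- x"] sublinear_0[OF m(1)] by simp
  have "m (c *\<^sub>R x) = c * m x" for c x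
  proof (cases "c \<ge> 0")
    case True
    then show ?thesis by (rule sublinear_scaleR_nonneg[OF m(1)])
  next
    case False
    then have "m ((- c) *\<^sub>R x) = (- c) * m x"
      by (intro sublinear_scaleR_nonneg[OF m(1)]) simp
    then show ?thesis
      using minus[of "c *\<^sub>R x"] by simp
  qed
  with add have "linear m"
    by (intro linearI) simp_all
  with m(2) that show thesis by blast
qed

text \<open>Shearing the norm along \<open>a\<close> gives \<open>q (- a) \<le> - norm a\<close>, so
  every linear functional below \<open>q\<close> is at least \<open>norm a\<close> at
  \<open>a\<close>.\<close>

lemma norming_real_functional:
  fixes a :: "'a::real_normed_vector"
  obtains f :: "'a \<Rightarrow> real" where "linear f" "\<And>x. f x \<le> norm x" "f a = norm a"
proof -
  obtain q :: "'a \<Rightarrow> real"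
    where q: "sublinear q" "q \<le> norm" "\<And>x. q x \<le> norm (x + a) - norm a"
    using sublinear_shear[OF sublinear_norm, of a] by blast
  obtain f where f: "linear f" "f \<le> q"
    using linear_below_sublinear[OF q(1)] .
  have le: "f x \<le> norm x" for x
    using f(2) q(2) by (meson le_funD order_trans)
  have "f (- a) \<le> - norm a"
    using le_funD[OF f(2), of "- a"] q(3)[of "- a"] by simp
  with le[of a] f(1) have "f a = norm a"
    by (simp add: linear_neg)
  with that f(1) le show thesis by blast
qed

section \<open>From real to complex functionals\<close>

lemma bounded_linear_scaleC_left:
  "bounded_linear (\<lambda>c. c *\<^sub>C (x::'a::complex_normed_vector))"
proof (rule bounded_linear_intro)
  show "(r *\<^sub>R c) *\<^sub>C x = r *\<^sub>R c *\<^sub>C x" for r c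
    by (simp add: scaleR_conv_of_real scaleC_of_real flip: scaleC_scaleC)
  show "norm (c *\<^sub>C x) \<le> norm c * norm x" for c
    by (simp add: norm_scaleC)
qed (rule scaleC_add_left)

lemma scaleC_conv_scaleR: "c *\<^sub>C x = Re c *\<^sub>R x + Im c *\<^sub>R \<i> *\<^sub>C x"
proof -
  have "c = complex_of_real (Re c) + complex_of_real (Im c) * \<i>"
    by (simp add: complex_eq_iff)
  from arg_cong[OF this, of "\<lambda>c. c *\<^sub>C x"] show ?thesis
    by (simp only: scaleC_add_left scaleC_of_real flip: scaleC_scaleC)
qed

text \<open>A complex-linear functional is recovered from its real part \<open>f\<close> as
  \<open>f x - \<i> * f (\<i> *\<^sub>C x)\<close>; this formula is applied to a real norming
  functional.\<close>

lemma norming_functional: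
  fixes a :: "'a::complex_normed_vector"
  obtains \<phi> where "bounded_linear \<phi>" "\<And>c x. \<phi> (c *\<^sub>C x) = c * \<phi> x"
    "\<And>x. cmod (\<phi> x) \<le> norm x" "\<phi> a = complex_of_real (norm a)"
proof -
  obtain f :: "'a \<Rightarrow> real" where f: "linear f" "\<And>x. f x \<le> norm x" "f a = norm a"
    using norming_real_functional[of a] by blast
  define \<phi> where "\<phi> x = Complex (f x) (- f (\<i> *\<^sub>C x))" for x
  have add: "\<phi> (x + y) = \<phi> x + \<phi> y" for x y
    by (simp add: \<phi>_def scaleC_add_right linear_add[OF f(1)] complex_eq_iff)
  have ii: "\<i> *\<^sub>C \<i> *\<^sub>C x = - x" for x :: 'a
    using scaleC_of_real[of "-1" x] by (simp add: scaleC_scaleC)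
  have i_scale: "\<i> *\<^sub>C r *\<^sub>R x = r *\<^sub>R \<i> *\<^sub>C x" for r and x :: 'a
    by (simp add: scaleC_scaleC mult.commute flip: scaleC_of_real)
  have scale: "\<phi> (c *\<^sub>C x) = c * \<phi> x" for c x
    by (simp add: \<phi>_def scaleC_conv_scaleR[of c x] scaleC_add_right i_scale ii
        linear_add[OF f(1)] linear_cmul[OF f(1)] linear_neg[OF f(1)] linear_diff[OF f(1)]
        complex_eq_iff algebra_simps)
  have le: "cmod (\<phi> x) \<le> norm x" for x
  proof (cases "\<phi> x = 0")
    case False
    \<comment> \<open>\<open>c\<close> rotates \<open>\<phi> x\<close> onto the positive real axis,
      where modulus and real part agree, so the bound on \<open>f\<close> becomes one on
      \<open>\<phi>\<close>.\<close>
    define c where "c = cnj (\<phi> x) / cmod (\<phi> x)"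
    have "cmod c = 1"
      using False by (simp add: c_def norm_divide)
    have "cnj (\<phi> x) * \<phi> x = complex_of_real (cmod (\<phi> x)) * cmod (\<phi> x)"
      using complex_norm_square[of "\<phi> x"] by (simp add: power2_eq_square mult.commute)
    then have "\<phi> (c *\<^sub>C x) = cmod (\<phi> x)"
      using False by (simp add: scale c_def)
    then have "cmod (\<phi> x) = f (c *\<^sub>C x)"
      by (simp add: \<phi>_def complex_eq_iff)
    also have "\<dots> \<le> norm (c *\<^sub>C x)"
      by (rule f(2))
    finally show ?thesis
      using \<open>cmod c = 1\<close> by (simp add: norm_scaleC)
  qed simp
  have "bounded_linear \<phi>"
  proof (rule bounded_linear_intro)
    show "\<phi> (r *\<^sub>R x) = r *\<^sub>R \<phi> x" for r x
      using scale[of "complex_of_real r" x] by (simp add: scaleC_of_real scaleR_conv_of_real)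
    show "norm (\<phi> x) \<le> norm x * 1" for x
      using le by simp
  qed (rule add)
  moreover have "\<phi> a = complex_of_real (norm a)"
  proof -
    \<comment> \<open>The real part of \<open>\<phi> a\<close> already uses up the whole bound
      \<open>norm a\<close>, which leaves no room for an imaginary part.\<close>
    have "(norm a)\<^sup>2 + (Im (\<phi> a))\<^sup>2 \<le> (norm a)\<^sup>2"
      using power_mono[OF le norm_ge_zero, of a 2] by (simp add: cmod_power2 \<phi>_def f(3))
    then show ?thesis
      by (simp add: \<phi>_def f(3) complex_eq_iff)
  qed
  ultimately show thesis
    using that scale le by blast
qed

section \<open>Weighted spaces of entire functions\<close>

lemma entire_mult:
  assumes "entire f" "entire g"
  shows "entire (\<lambda>x. f x * g x)"
  unfolding entire_def
proof
  fix x
  obtain D E where D: "(f has_derivative D) (at x)" "\<And>c y. D (c *\<^sub>C y) = c * D y"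
    and E: "(g has_derivative E) (at x)" "\<And>c y. E (c *\<^sub>C y) = c * E y"
    using assms unfolding entire_def by metis
  have "((\<lambda>x. f x * g x) has_derivative (\<lambda>h. f x * E h + D h * g x)) (at x)"
    by (rule has_derivative_mult[OF D(1) E(1)])
  moreover have "f x * E (c *\<^sub>C y) + D (c *\<^sub>C y) * g x = c * (f x * E y + D y * g x)" for c y
    by (simp add: D(2) E(2) algebra_simps)
  ultimately show "\<exists>D. ((\<lambda>x. f x * g x) has_derivative D) (at x) \<and>
      (\<forall>c y. D (c *\<^sub>C y) = c * D y)"
    by blast
qed

text \<open>Carries one-variable test functions over to the Banach space: homogeneity of
  \<open>\<phi>\<close> makes the chain-rule derivative complex-linear.\<close>

lemma entire_holomorphic_compose:
  assumes g: "g holomorphic_on UNIV"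
    and \<phi>: "bounded_linear \<phi>" "\<And>c x. \<phi> (c *\<^sub>C x) = c * \<phi> x"
  shows "entire (\<lambda>x. g (\<phi> x))"
  unfolding entire_def
proof
  fix x
  have "(g has_derivative (*) (deriv g (\<phi> x))) (at (\<phi> x))"
    using holomorphic_derivI[OF g open_UNIV, of "\<phi> x"] by (simp add: has_field_derivative_def)
  from has_derivative_compose[OF bounded_linear_imp_has_derivative[OF \<phi>(1)] this]
  show "\<exists>D. ((\<lambda>x. g (\<phi> x)) has_derivative D) (at x) \<and> (\<forall>c y. D (c *\<^sub>C y) = c * D y)"
    by (intro exI conjI) (assumption, simp add: \<phi>(2))
qed

lemma entire_holomorphic_line:
  assumes "entire f"
  shows "(\<lambda>z. f (z *\<^sub>C x)) holomorphic_on UNIV"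
proof (rule holomorphic_onI)
  fix z
  obtain D where D: "(f has_derivative D) (at (z *\<^sub>C x))" "\<And>c y. D (c *\<^sub>C y) = c * D y"
    using assms unfolding entire_def by metis
  have "((\<lambda>z. f (z *\<^sub>C x)) has_derivative (\<lambda>h. D (h *\<^sub>C x))) (at z)"
    by (rule has_derivative_compose[OF bounded_linear_imp_has_derivative[OF
            bounded_linear_scaleC_left] D(1)])
  \<comment> \<open>Complex homogeneity of \<open>D\<close> turns the derivative along the line into
    multiplication by one complex number.\<close>
  moreover have "(\<lambda>h. D (h *\<^sub>C x)) = (*) (D x)"
    by (simp add: fun_eq_iff D(2) mult.commute)
  ultimately have "((\<lambda>z. f (z *\<^sub>C x)) has_field_derivative D x) (at z)"
    by (simp add: has_field_derivative_def)
  then show "(\<lambda>z. f (z *\<^sub>C x)) field_differentiable at z"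
    by (auto simp: field_differentiable_def)
qed

lemma weighted_spaceD:
  assumes "f \<in> weighted_space V"
  shows "entire f" "v \<in> V \<Longrightarrow> bdd_above (range (\<lambda>x. v x * cmod (f x)))"
  using assms by (auto simp: weighted_space_def)

lemma weighted_spaceI:
  assumes "entire f" "\<And>v. v \<in> V \<Longrightarrow> \<exists>B. \<forall>x. v x * cmod (f x) \<le> B"
  shows "f \<in> weighted_space V"
  using assms unfolding weighted_space_def by (force intro: bdd_aboveI2)

lemma weighted_norm_upper:
  assumes "f \<in> weighted_space V" "v \<in> V"
  shows "v x * cmod (f x) \<le> weighted_norm v f"
  unfolding weighted_norm_def by (rule cSUP_upper) (use weighted_spaceD[OF assms(1)] assms(2) in auto)

lemma weighted_norm_least:
  assumes "\<And>x. v x * cmod (f x) \<le> B"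
  shows "weighted_norm v f \<le> B"
  unfolding weighted_norm_def by (rule cSUP_least) (use assms in auto)

lemma weighted_norm_zero [simp]: "weighted_norm v (\<lambda>x. 0) = 0"
  by (simp add: weighted_norm_def)

lemma weighted_norm_diff_bdd:
  assumes "f \<in> weighted_space V" "g \<in> weighted_space V" "v \<in> V" "\<And>x. v x \<ge> 0"
  shows "v x * cmod (f x - g x) \<le> weighted_norm v (\<lambda>x. f x - g x)"
  unfolding weighted_norm_def
proof (rule cSUP_upper)
  have "v x * cmod (f x - g x) \<le> weighted_norm v f + weighted_norm v g" for x
  proof -
    have "v x * cmod (f x - g x) \<le> v x * (cmod (f x) + cmod (g x))"
      by (intro mult_left_mono norm_triangle_ineq4 assms(4))
    also have "\<dots> \<le> weighted_norm v f + weighted_norm v g"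
      using assms(1-3) by (simp add: distrib_left add_mono weighted_norm_upper)
    finally show ?thesis .
  qed
  then show "bdd_above (range (\<lambda>x. v x * cmod (f x - g x)))"
    by (rule bdd_aboveI2)
qed simp

text \<open>Domination of weights bounds each seminorm of \<open>V\<close> by a multiple of one of
  \<open>W\<close>. The target topology is generated by balls, so openness is checked on preimages
  of balls.\<close>

lemma weighted_inclusion_continuous:
  fixes V W :: "('a::complex_normed_vector \<Rightarrow> real) set"
  assumes nonempty: "V \<noteq> {}"
    and V_nonneg: "\<And>v x. v \<in> V \<Longrightarrow> v x \<ge> 0"
    and W_nonneg: "\<And>w x. w \<in> W \<Longrightarrow> w x \<ge> 0"
    and dominated: "\<And>v. v \<in> V \<Longrightarrow> \<exists>w\<in>W. \<exists>C>0. \<forall>x. v x \<le> C * w x"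
  shows "continuous_map (weighted_topology W) (weighted_topology V) (\<lambda>f. f)"
proof -
  let ?B = "\<lambda>V v f r. {g \<in> weighted_space V. weighted_norm v (\<lambda>x. g x - f x) < r}"
  let ?S = "\<lambda>V. {?B V v f r | v f r. v \<in> V \<and> f \<in> weighted_space V \<and> r > 0}"
  have sub: "f \<in> weighted_space V" if f: "f \<in> weighted_space W" for f
  proof (rule weighted_spaceI)
    show "entire f" using f by (rule weighted_spaceD)
    fix v assume "v \<in> V"
    then obtain w C where w: "w \<in> W" "C > 0" "\<forall>x. v x \<le> C * w x"
      using dominated by blast
    have "v x * cmod (f x) \<le> C * weighted_norm w f" for x
    proof -
      have "v x * cmod (f x) \<le> (C * w x) * cmod (f x)"
        using w(3) by (intro mult_right_mono) auto
      also have "\<dots> \<le> C * weighted_norm w f"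
        using weighted_norm_upper[OF f w(1), of x] w(2) by (simp add: mult.assoc)
      finally show ?thesis .
    qed
    then show "\<exists>B. \<forall>x. v x * cmod (f x) \<le> B" by blast
  qed
  have top: "topspace (weighted_topology U) \<subseteq> weighted_space U" for U :: "('a \<Rightarrow> real) set"
    unfolding weighted_topology_def topology_generated_by_topspace by auto
  show ?thesis
    unfolding weighted_topology_def[of V]
  proof (rule continuous_on_generated_topo)
    fix U assume "U \<in> ?S V"
    then obtain v f r where U: "U = ?B V v f r"
      and v: "v \<in> V" and f: "f \<in> weighted_space V" and r: "r > 0"
      by blast
    obtain w C where w: "w \<in> W" "C > 0" "\<forall>x. v x \<le> C * w x"
      using dominated[OF v] by blast
    have "\<exists>T. openin (weighted_topology W) T \<and> g \<in> T \<and>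
        T \<subseteq> (\<lambda>f. f) -` U \<inter> topspace (weighted_topology W)"
      if g: "g \<in> (\<lambda>f. f) -` U \<inter> topspace (weighted_topology W)" for g
    proof -
      \<comment> \<open>\<open>e\<close> is the room left between \<open>g\<close> and the boundary
        of the ball \<open>U\<close>, divided by the constant lost in passing from \<open>w\<close>
        to \<open>v\<close>.\<close>
      define e where "e = (r - weighted_norm v (\<lambda>x. g x - f x)) / C"
      have gW: "g \<in> weighted_space W" using g top by blast
      have e: "e > 0" using g w(2) by (simp add: e_def U)
      define T where "T = ?B W w g e"
      have "openin (weighted_topology W) T"
        unfolding weighted_topology_def T_def
        by (rule topology_generated_by_Basis) (use w(1) gW e in blast)
      moreover have "g \<in> T"
        using gW e by (simp add: T_def)
      moreover have "h \<in> U" if "h \<in> T" for h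
      proof -
        have hW: "h \<in> weighted_space W" and less: "weighted_norm w (\<lambda>x. h x - g x) < e"
          using that by (auto simp: T_def)
        have "weighted_norm v (\<lambda>x. h x - f x) \<le>
            C * weighted_norm w (\<lambda>x. h x - g x) + weighted_norm v (\<lambda>x. g x - f x)"
        proof (rule weighted_norm_least)
          fix x
          have "v x * cmod (h x - f x) \<le> v x * (cmod (h x - g x) + cmod (g x - f x))"
            using norm_triangle_ineq[of "h x - g x" "g x - f x"]
            by (intro mult_left_mono V_nonneg[OF v]) simp
          also have "\<dots> = v x * cmod (h x - g x) + v x * cmod (g x - f x)"
            by (rule distrib_left)
          also have "v x * cmod (h x - g x) \<le> (C * w x) * cmod (h x - g x)"
            using w(3) by (intro mult_right_mono) auto
          also have "\<dots> \<le> C * weighted_norm w (\<lambda>x. h x - g x)"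
            using weighted_norm_diff_bdd[OF hW gW w(1) W_nonneg[OF w(1)], of x] w(2)
            by (simp add: mult.assoc)
          also have "v x * cmod (g x - f x) \<le> weighted_norm v (\<lambda>x. g x - f x)"
            by (rule weighted_norm_diff_bdd[OF sub[OF gW] f v V_nonneg[OF v]])
          finally show "v x * cmod (h x - f x) \<le>
              C * weighted_norm w (\<lambda>x. h x - g x) + weighted_norm v (\<lambda>x. g x - f x)"
            by simp
        qed
        also have "\<dots> < r"
          using less w(2) by (simp add: e_def field_simps)
        finally show ?thesis
          using sub[OF hW] by (simp add: U)
      qed
      ultimately show ?thesis
        using openin_subset by (intro exI[of _ T]) auto
    qed
    then show "openin (weighted_topology W) ((\<lambda>f. f) -` U \<inter> topspace (weighted_topology W))"
      using openin_subopen by (metis (no_types, lifting))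
  next
    \<comment> \<open>The image must also lie in the union of the generating balls; each
      \<open>f\<close> lies in the ball of radius 1 about itself for any weight in
      \<open>V\<close>.\<close>
    obtain v where "v \<in> V" using nonempty by blast
    have "f \<in> \<Union> (?S V)" if "f \<in> weighted_space W" for f
    proof -
      have "f \<in> ?B V v f 1" "?B V v f 1 \<in> ?S V"
        using sub[OF that] \<open>v \<in> V\<close> by (auto intro!: exI[of _ v] exI[of _ f] exI[of _ 1])
      then show ?thesis by blast
    qed
    then show "(\<lambda>f. f) ` topspace (weighted_topology W) \<subseteq> \<Union> (?S V)"
      unfolding image_ident using top by (meson subsetD subsetI)
  qed
qed

section \<open>Radial weights\<close>

locale radial_weight =
  fixes \<eta> :: "real \<Rightarrow> real"
  assumes pos: "t \<ge> 0 \<Longrightarrow> \<eta> t > 0"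
    and decreasing: "antimono_on {0..} \<eta>"
begin

lemma mono: "0 \<le> s \<Longrightarrow> s \<le> t \<Longrightarrow> \<eta> t \<le> \<eta> s"
  using decreasing by (auto simp: monotone_on_def)

lemma inverse_mono: "0 \<le> s \<Longrightarrow> s \<le> t \<Longrightarrow> 1 / \<eta> s \<le> 1 / \<eta> t"
  using mono[of s t] pos[of t] by (simp add: frac_le)

section \<open>Competitors for the associated weight\<close>

definition unit_ball :: "(complex \<Rightarrow> complex) set"
  where "unit_ball = {g. g holomorphic_on UNIV \<and> (\<forall>z. cmod (g z) \<le> 1 / \<eta> (cmod z))}"

lemma unit_ballD:
  assumes "g \<in> unit_ball"
  shows "g holomorphic_on UNIV" "cmod (g z) \<le> 1 / \<eta> (cmod z)"
  using assms unfolding unit_ball_def by blast+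

lemma associated_weight_eq:
  "associated_weight \<eta> t = 1 / (SUP g\<in>unit_ball. cmod (g (complex_of_real t)))"
  unfolding associated_weight_def unit_ball_def
  by (rule arg_cong[where f = "\<lambda>A. 1 / Sup A"]) auto

text \<open>A constant competitor exists because \<open>1 / \<eta>\<close> is smallest at 0. It
  makes the index set of the supremum nonempty and the supremum positive.\<close>

lemma const_unit_ball: "(\<lambda>z. complex_of_real (1 / \<eta> 0)) \<in> unit_ball"
  using inverse_mono pos[of 0] by (auto simp: unit_ball_def norm_divide)

lemma unit_ball_bdd:
  assumes "t \<ge> 0"
  shows "bdd_above ((\<lambda>g. cmod (g (complex_of_real t))) ` unit_ball)"
proof (rule bdd_aboveI2)
  fix g assume "g \<in> unit_ball"
  then have "cmod (g (complex_of_real t)) \<le> 1 / \<eta> (cmod (complex_of_real t))"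
    by (rule unit_ballD(2))
  with assms show "cmod (g (complex_of_real t)) \<le> 1 / \<eta> t" by simp
qed

lemma associated_weight_pos:
  assumes "t \<ge> 0"
  shows "associated_weight \<eta> t > 0"
proof -
  have "0 < cmod (complex_of_real (1 / \<eta> 0))"
    using pos[of 0] by simp
  also have "\<dots> \<le> (SUP g\<in>unit_ball. cmod (g (complex_of_real t)))"
    by (rule cSUP_upper2[OF unit_ball_bdd[OF assms] const_unit_ball]) simp
  finally show ?thesis by (simp add: associated_weight_eq)
qed

lemma unit_ball_le_associated_weight:
  assumes "t \<ge> 0" "g \<in> unit_ball"
  shows "cmod (g (complex_of_real t)) \<le> 1 / associated_weight \<eta> t"
  using cSUP_upper[OF assms(2) unit_ball_bdd[OF assms(1)]] by (simp add: associated_weight_eq)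

lemma inverse_associated_weight_least:
  assumes "\<And>g. g \<in> unit_ball \<Longrightarrow> cmod (g (complex_of_real t)) \<le> B"
  shows "1 / associated_weight \<eta> t \<le> B"
proof -
  have "(SUP g\<in>unit_ball. cmod (g (complex_of_real t))) \<le> B"
    by (rule cSUP_least) (use const_unit_ball assms in auto)
  then show ?thesis by (simp add: associated_weight_eq)
qed

lemma weight_le_associated_weight:
  assumes "t \<ge> 0"
  shows "\<eta> t \<le> associated_weight \<eta> t"
proof -
  have "1 / associated_weight \<eta> t \<le> 1 / \<eta> t"
  proof (rule inverse_associated_weight_least)
    fix g assume "g \<in> unit_ball"
    then have "cmod (g (complex_of_real t)) \<le> 1 / \<eta> (cmod (complex_of_real t))"
      by (rule unit_ballD(2))
    with assms show "cmod (g (complex_of_real t)) \<le> 1 / \<eta> t" by simp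
  qed
  then show ?thesis
    using pos[OF assms] associated_weight_pos[OF assms] by (simp add: field_simps)
qed

text \<open>For \<open>A > 0\<close>, dilating \<open>f\<close> along the complex line through
  \<open>x\<close> and dividing by \<open>A\<close> gives a member of \<open>unit_ball\<close> with
  value \<open>f x / A\<close> at \<open>norm x / m\<close>.\<close>

lemma entire_le_associated_weight:
  fixes f :: "'a::complex_normed_vector \<Rightarrow> complex"
  assumes f: "entire f" and m: "m > 0"
    and bound: "\<And>x. \<eta> (norm x / m) * cmod (f x) \<le> A"
  shows "cmod (f x) \<le> A / associated_weight \<eta> (norm x / m)"
proof -
  have A: "A \<ge> 0"
    using order_trans[OF _ bound[of 0]] pos[of 0] by simp
  show ?thesis
  proof (cases "A = 0")
    case True
    with bound[of x] pos[of "norm x / m"] m show ?thesis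
      by (simp add: mult_le_0_iff)
  next
    case False
    with A have A: "A > 0" by simp
    \<comment> \<open>For \<open>x = 0\<close> also \<open>u = 0\<close>, so only
      \<open>norm u \<le> 1\<close> is available; monotonicity of \<open>\<eta>\<close> absorbs the
      inequality.\<close>
    define u where "u = sgn x"
    have u: "norm u \<le> 1" "norm x *\<^sub>R u = x"
      by (cases "x = 0"; simp add: u_def norm_sgn; simp add: sgn_div_norm)+
    define g where "g z = f (z *\<^sub>C (m *\<^sub>R u)) / A" for z
    have "cmod (g z) \<le> 1 / \<eta> (cmod z)" for z
    proof -
      let ?y = "z *\<^sub>C (m *\<^sub>R u)"
      have "norm ?y / m = cmod z * norm u"
        using m by (simp add: norm_scaleC)
      also have "\<dots> \<le> cmod z"
        using u(1) by (simp add: mult_left_le)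
      finally have "\<eta> (cmod z) \<le> \<eta> (norm ?y / m)"
        using m by (intro mono) auto
      then have "\<eta> (cmod z) * cmod (f ?y) \<le> A"
        by (intro order_trans[OF mult_right_mono bound]) auto
      then show ?thesis
        using A pos[of "cmod z"] by (simp add: g_def norm_divide field_simps)
    qed
    moreover have "g holomorphic_on UNIV"
      unfolding g_def using A by (intro holomorphic_intros entire_holomorphic_line f) auto
    ultimately have "cmod (g (complex_of_real (norm x / m))) \<le> 1 / associated_weight \<eta> (norm x / m)"
      using m by (intro unit_ball_le_associated_weight) (auto simp: unit_ball_def)
    moreover have "complex_of_real (norm x / m) *\<^sub>C (m *\<^sub>R u) = x"
      using m u(2) by (simp only: scaleC_of_real scaleR_scaleR) simp
    ultimately have "cmod (f x) / A \<le> 1 / associated_weight \<eta> (norm x / m)"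
      using A by (simp add: g_def norm_divide)
    then show ?thesis
      using A by (simp add: field_simps)
  qed
qed

text \<open>Each factor of the product consumes one power of the associated weight, which is why its
  square appears in the hypothesis.\<close>

lemma dilation_weights_algebraI:
  fixes W :: "('a::complex_normed_vector \<Rightarrow> real) set"
  defines "W \<equiv> dilation_weights \<eta>"
  assumes k: "k > 0" and C: "C > 0"
    and le: "\<And>t. t \<ge> 0 \<Longrightarrow> \<eta> (k * t) \<le> C * (associated_weight \<eta> t)\<^sup>2"
  shows "weighted_space_is_algebra W"
proof -
  \<comment> \<open>The estimate is pointwise, so that it yields both finiteness of the supremum for
    the product and the norm inequality.\<close>
  have key: "\<exists>w\<in>W. \<forall>f\<in>weighted_space W. \<forall>g\<in>weighted_space W. \<forall>x.
      v x * cmod (f x * g x) \<le> C * weighted_norm w f * weighted_norm w g" if v_W: "v \<in> W" for v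
  proof -
    obtain n where v: "v = (\<lambda>x. \<eta> (norm x / real n))" and n: "n \<ge> 1"
      using v_W by (auto simp: W_def dilation_weights_def)
    \<comment> \<open>The dilations in \<open>W\<close> are by integers, so \<open>k * n\<close> is
      rounded up; then \<open>k * s \<le> norm x / n\<close> for
      \<open>s = norm x / m\<close>.\<close>
    define m where "m = nat \<lceil>k * n\<rceil>"
    have m: "real m \<ge> k * n" unfolding m_def by linarith
    moreover have "k * n > 0" using k n by simp
    ultimately have m0: "real m > 0" by linarith
    define w :: "'a \<Rightarrow> real" where "w = (\<lambda>x. \<eta> (norm x / real m))"
    have w: "w \<in> W"
      using m0 by (auto simp: W_def dilation_weights_def w_def)
    have "v x * cmod (f x * g x) \<le> C * weighted_norm w f * weighted_norm w g"
      if f: "f \<in> weighted_space W" and g: "g \<in> weighted_space W" for f g x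
    proof -
      define s where "s = norm x / m"
      define a where "a = associated_weight \<eta> s"
      have s: "s \<ge> 0" by (simp add: s_def)
      have a: "a > 0" using associated_weight_pos[OF s] by (simp add: a_def)
      have bd: "a * cmod (h x) \<le> weighted_norm w h" if h: "h \<in> weighted_space W" for h
        using entire_le_associated_weight[OF weighted_spaceD(1)[OF h] m0, of "weighted_norm w h" x]
          weighted_norm_upper[OF h w] a
        by (simp add: w_def a_def s_def field_simps)
      have "k * s \<le> norm x / n"
        using m m0 n mult_right_mono[OF m, of "norm x"] by (simp add: s_def field_simps)
      then have "v x \<le> \<eta> (k * s)"
        using k s by (simp add: v mono)
      also have "\<dots> \<le> C * a\<^sup>2"
        unfolding a_def by (rule le[OF s])
      finally have "v x * cmod (f x * g x) \<le> (C * a\<^sup>2) * cmod (f x * g x)"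
        by (rule mult_right_mono) simp
      also have "\<dots> = C * ((a * cmod (f x)) * (a * cmod (g x)))"
        by (simp add: norm_mult power2_eq_square)
      also have "\<dots> \<le> C * (weighted_norm w f * weighted_norm w g)"
        using C a order_trans[OF _ bd[OF f]]
        by (intro mult_left_mono mult_mono bd f g) auto
      finally show ?thesis by (simp add: mult.assoc)
    qed
    with w show ?thesis by blast
  qed
  show ?thesis
    unfolding weighted_space_is_algebra_def
  proof (intro conjI ballI)
    fix f g assume fg: "f \<in> weighted_space W" "g \<in> weighted_space W"
    show "(\<lambda>x. f x * g x) \<in> weighted_space W"
    proof (rule weighted_spaceI)
      show "entire (\<lambda>x. f x * g x)"
        by (intro entire_mult weighted_spaceD(1)[OF fg(1)] weighted_spaceD(1)[OF fg(2)])
      show "\<exists>B. \<forall>x. v x * cmod (f x * g x) \<le> B" if "v \<in> W" for v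
        using key[OF that] fg by blast
    qed
  next
    fix v assume "v \<in> W"
    then obtain w where "w \<in> W" "\<forall>f\<in>weighted_space W. \<forall>g\<in>weighted_space W. \<forall>x.
      v x * cmod (f x * g x) \<le> C * weighted_norm w f * weighted_norm w g"
      using key by blast
    with C show "\<exists>u1\<in>W. \<exists>u2\<in>W. \<exists>C>0. \<forall>f\<in>weighted_space W. \<forall>g\<in>weighted_space W.
        weighted_norm v (\<lambda>x. f x * g x) \<le> C * weighted_norm u1 f * weighted_norm u2 g"
      by (intro bexI[of _ w] exI[of _ C] conjI ballI weighted_norm_least) auto
  qed
qed

section \<open>Taylor polynomials of competitors\<close>

lemma taylor_coeff_bound:
  assumes "g \<in> unit_ball"
  shows "cmod ((deriv ^^ j) g 0 / fact j) * cmod z ^ j \<le> 1 / \<eta> (cmod z)"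
proof (cases "z = 0")
  \<comment> \<open>Cauchy's inequality needs a positive radius; at 0 only the coefficient with
    \<open>j = 0\<close> counts.\<close>
  case True
  have "cmod (g 0) \<le> 1 / \<eta> (cmod 0)"
    by (rule unit_ballD(2)[OF assms])
  with True pos[of 0] show ?thesis by (cases j) auto
next
  case False
  have g: "g holomorphic_on UNIV" by (rule unit_ballD(1)[OF assms])
  \<comment> \<open>On the circle of radius \<open>cmod z\<close> the majorant
    \<open>1 / \<eta>\<close> is constant, so it can serve directly as the Cauchy bound.\<close>
  have "cmod ((deriv ^^ j) g 0) \<le> fact j * (1 / \<eta> (cmod z)) / cmod z ^ j"
  proof (rule Cauchy_inequality)
    show "continuous_on (cball 0 (cmod z)) g"
      using g by (meson continuous_on_subset holomorphic_on_imp_continuous_on subset_UNIV)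
    show "cmod (g x) \<le> 1 / \<eta> (cmod z)" if "cmod (0 - x) = cmod z" for x
      using unit_ballD(2)[OF assms, of x] that by simp
  qed (use g False in \<open>auto intro: holomorphic_on_subset\<close>)
  then show ?thesis
    using False pos[of "cmod z"] by (simp add: norm_divide field_simps)
qed

text \<open>Halving the argument turns the Cauchy estimates into a geometric series, so Taylor
  polynomials stay in a multiple of the unit ball; this replaces Cesaro means.\<close>

lemma taylor_polynomial_bound:
  assumes "g \<in> unit_ball"
  shows "cmod (\<Sum>j<N. (deriv ^^ j) g 0 / fact j * (z / 2) ^ j) \<le> 2 / \<eta> (cmod z)"
proof -
  have "cmod (\<Sum>j<N. (deriv ^^ j) g 0 / fact j * (z / 2) ^ j)
      \<le> (\<Sum>j<N. 1 / \<eta> (cmod z) * (1 / 2) ^ j)"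
  proof (rule sum_norm_le)
    fix j
    have "cmod ((deriv ^^ j) g 0 / fact j * (z / 2) ^ j) =
        (cmod ((deriv ^^ j) g 0 / fact j) * cmod z ^ j) * (1 / 2) ^ j"
      by (simp add: norm_mult norm_power norm_divide power_divide)
    also have "\<dots> \<le> 1 / \<eta> (cmod z) * (1 / 2) ^ j"
      by (intro mult_right_mono taylor_coeff_bound assms) simp
    finally show "cmod ((deriv ^^ j) g 0 / fact j * (z / 2) ^ j) \<le> 1 / \<eta> (cmod z) * (1 / 2) ^ j" .
  qed
  also have "\<dots> = 1 / \<eta> (cmod z) * (\<Sum>j<N. (1 / 2) ^ j)"
    by (rule sum_distrib_left[symmetric])
  also have "(\<Sum>j<N. (1 / 2 :: real) ^ j) = 2 - 2 * (1 / 2) ^ N"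
    by (subst sum_gp_strict) simp
  also have "1 / \<eta> (cmod z) * \<dots> \<le> 1 / \<eta> (cmod z) * 2"
    using pos[of "cmod z"] by (intro mult_left_mono) simp_all
  finally show ?thesis by simp
qed

section \<open>Iteration of the squaring inequality: domination of weights and decay\<close>

lemma iterate_doubling:
  assumes k: "k \<ge> 1" and C: "C > 0" and le: "\<And>t. t \<ge> 0 \<Longrightarrow> \<eta> (k * t) \<le> C * (\<eta> t)\<^sup>2"
  shows "\<exists>r\<ge>1. \<exists>B>0. \<forall>t\<ge>0. \<eta> t \<le> B * \<eta> (t / r) ^ n"
proof (induction n)
  case 0
  show ?case
    using mono[of 0] pos[of 0] by (intro exI[of _ 1] conjI exI[of _ "\<eta> 0"]) auto
next
  case (Suc n)
  then obtain r B where r: "r \<ge> 1" "B > 0" "\<And>t. t \<ge> 0 \<Longrightarrow> \<eta> t \<le> B * \<eta> (t / r) ^ n"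
    by blast
  have "\<eta> t \<le> (C * B) * \<eta> (t / (k * r)) ^ Suc n" if "t \<ge> 0" for t
  proof -
    have t: "t / k \<ge> 0" using that k by simp
    have "\<eta> t \<le> C * (\<eta> (t / k) * \<eta> (t / k))"
      using le[OF t] k by (simp add: power2_eq_square)
    \<comment> \<open>Of the two factors \<open>\<eta> (t / k)\<close>, one is enlarged by shrinking
      its argument and the other is handled by the induction hypothesis; so each round gains one
      power.\<close>
    also have "\<dots> \<le> C * (\<eta> (t / (k * r)) * (B * \<eta> (t / (k * r)) ^ n))"
    proof (intro mult_left_mono mult_mono)
      have "t / k / r \<le> t / k"
        using divide_left_mono[of 1 r "t / k"] t r(1) by simp
      then show "\<eta> (t / k) \<le> \<eta> (t / (k * r))"
        using that k r(1) by (intro mono) simp_all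
      show "\<eta> (t / k) \<le> B * \<eta> (t / (k * r)) ^ n"
        using r(3)[OF t] by (simp add: field_simps)
    qed (use C t that k r(1) pos[of "t / k"] pos[of "t / (k * r)"] in auto)
    finally show ?thesis by (simp add: algebra_simps)
  qed
  moreover have "k * r \<ge> 1" "C * B > 0"
    using k r C mult_mono[of 1 k 1 r] by auto
  ultimately show ?case by blast
qed

text \<open>The \<open>n\<close>-th root of the iterated inequality compares a power weight with a
  dilation weight. Rounding \<open>r\<close> up to an integer only increases the right-hand
  side.\<close>

lemma power_weight_dominated:
  fixes n :: nat
  assumes k: "k \<ge> 1" and C: "C > 0" and le: "\<And>t. t \<ge> 0 \<Longrightarrow> \<eta> (k * t) \<le> C * (\<eta> t)\<^sup>2"
    and n: "n \<ge> 1"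
  shows "\<exists>m\<ge>1::nat. \<exists>B>0. \<forall>t\<ge>0. \<eta> t powr (1 / n) \<le> B * \<eta> (t / m)"
proof -
  obtain r B where r: "r \<ge> 1" "B > 0" "\<And>t. t \<ge> 0 \<Longrightarrow> \<eta> t \<le> B * \<eta> (t / r) ^ n"
    using iterate_doubling[OF k C le, of n] by blast
  define m where "m = nat \<lceil>r\<rceil>"
  have m: "real m \<ge> r" unfolding m_def by linarith
  have "\<eta> t powr (1 / n) \<le> B powr (1 / n) * \<eta> (t / m)" if "t \<ge> 0" for t
  proof -
    have p: "\<eta> (t / m) > 0" using that by (intro pos) simp
    have "t / m \<le> t / r" using that r(1) m by (intro divide_left_mono) auto
    then have "\<eta> (t / r) \<le> \<eta> (t / m)" using that by (intro mono) auto
    then have "\<eta> (t / r) ^ n \<le> \<eta> (t / m) ^ n"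
      using pos[of "t / r"] that r(1) by (intro power_mono) auto
    then have "\<eta> t \<le> B * \<eta> (t / m) ^ n"
      using r(3)[OF that] r(2) by (meson order_trans mult_left_mono less_imp_le)
    then have "\<eta> t powr (1 / n) \<le> (B * \<eta> (t / m) ^ n) powr (1 / n)"
      using pos[OF that] by (intro powr_mono2) auto
    also have "\<dots> = B powr (1 / n) * \<eta> (t / m)"
      using r(2) p n by (simp add: powr_mult powr_powr flip: powr_realpow)
    finally show ?thesis .
  qed
  moreover have "m \<ge> 1" using m r(1) by linarith
  ultimately show ?thesis using r(2) by (intro exI[of _ m] conjI exI[of _ "B powr (1 / n)"]) auto
qed

text \<open>Along \<open>k ^ j * t0\<close> each step squares the bound on
  \<open>C * \<eta>\<close>, giving \<open>exp (- (2 ^ j))\<close>. As \<open>2 ^ j\<close> is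
  \<open>k ^ j\<close> raised to the power \<open>log k 2\<close>, this is a stretched exponential
  in \<open>t\<close>.\<close>

lemma exponential_decay:
  assumes k: "k > 1" and C: "C > 0" and le: "\<And>t. t \<ge> 0 \<Longrightarrow> \<eta> (k * t) \<le> C * (\<eta> t)\<^sup>2"
    and lim: "(\<eta> \<longlongrightarrow> 0) at_top"
  shows "\<exists>a>0. \<exists>b>0. \<exists>\<alpha>>0. \<forall>t\<ge>0. \<eta> t \<le> a * exp (- b * t powr \<alpha>)"
proof -
  \<comment> \<open>Starting with \<open>C * \<eta> t0 < exp (-1)\<close> makes repeated squaring
    decay, and \<open>t0 > 0\<close> lets the points \<open>k ^ j * t0\<close> tend to
    infinity.\<close>
  have "\<forall>\<^sub>F t in at_top. \<eta> t < exp (-1) / C"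
    by (rule order_tendstoD(2)[OF lim]) (use C in simp)
  then have "\<forall>\<^sub>F t in at_top. \<eta> t < exp (-1) / C \<and> t > 0"
    using eventually_gt_at_top by (rule eventually_conj)
  then obtain t0 where t0: "\<eta> t0 < exp (-1) / C" "t0 > 0"
    unfolding eventually_at_top_linorder by blast
  have iter: "C * \<eta> (k ^ j * t0) \<le> exp (- (2 ^ j))" for j
  proof (induction j)
    case 0
    then show ?case using t0 C by (simp add: field_simps)
  next
    case (Suc j)
    have nn: "k ^ j * t0 \<ge> 0" using k t0 by simp
    have "C * \<eta> (k ^ Suc j * t0) \<le> C * (C * (\<eta> (k ^ j * t0))\<^sup>2)"
      using le[OF nn] C by (simp add: mult.assoc)
    also have "\<dots> = (C * \<eta> (k ^ j * t0))\<^sup>2"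
      by (simp add: power2_eq_square)
    also have "\<dots> \<le> (exp (- (2 ^ j)))\<^sup>2"
      using Suc C pos[OF nn] by (intro power_mono) auto
    also have "\<dots> = exp (- (2 ^ Suc j))"
      by (simp add: power2_eq_square flip: exp_add)
    finally show ?case .
  qed
  define \<alpha> where "\<alpha> = log k 2"
  \<comment> \<open>The factor 1/2 in \<open>b\<close> pays for rounding \<open>t\<close> down to
    some \<open>k ^ j * t0\<close>. The two summands of \<open>a\<close> serve \<open>t < t0\<close>
    and \<open>t \<ge> t0\<close>.\<close>
  define b where "b = t0 powr (- \<alpha>) / 2"
  define a where "a = \<eta> 0 * exp (1 / 2) + 1 / C"
  have \<alpha>: "\<alpha> > 0" using k by (simp add: \<alpha>_def)
  have bt: "b * t powr \<alpha> = (t / t0) powr \<alpha> / 2" if "t \<ge> 0" for t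
    using that t0 by (simp add: b_def powr_divide powr_minus field_simps)
  have "\<eta> t \<le> a * exp (- b * t powr \<alpha>)" if "t \<ge> 0" for t
  proof (cases "t < t0")
    case True
    have "(t / t0) powr \<alpha> \<le> 1 powr \<alpha>"
      using True that t0 \<alpha> by (intro powr_mono2) auto
    then have "1 \<le> exp (1 / 2) * exp (- b * t powr \<alpha>)"
      using bt[OF that] by (simp flip: exp_add)
    then have "\<eta> 0 * 1 \<le> \<eta> 0 * (exp (1 / 2) * exp (- b * t powr \<alpha>))"
      using pos[of 0] by (intro mult_left_mono) auto
    also have "\<dots> \<le> a * exp (- b * t powr \<alpha>)"
      using C by (simp add: a_def distrib_right)
    finally show ?thesis
      using mono[of 0 t] that by simp
  next
    case False
    define q where "q = t / t0"
    have q: "q \<ge> 1" using False t0 by (simp add: q_def)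
    \<comment> \<open>\<open>j\<close> is largest with \<open>k ^ j \<le> q\<close>; hence
      \<open>q < k ^ Suc j\<close> and \<open>q powr \<alpha> \<le> 2 * 2 ^ j\<close>.\<close>
    define j where "j = nat \<lfloor>log k q\<rfloor>"
    have "log k q \<ge> 0" using k q by simp
    then have j: "real j \<le> log k q" "log k q < real (Suc j)"
      unfolding j_def by linarith+
    have "k ^ j = k powr real j" using k by (simp add: powr_realpow)
    also have "\<dots> \<le> k powr log k q" using j(1) k by (intro powr_mono) auto
    also have "\<dots> = q" using k q by simp
    finally have "k ^ j * t0 \<le> t" using t0 by (simp add: q_def field_simps)
    then have "C * \<eta> t \<le> C * \<eta> (k ^ j * t0)"
      using C k t0 by (intro mult_left_mono mono) auto
    also have "\<dots> \<le> exp (- (2 ^ j))" by (rule iter)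
    also have "\<dots> \<le> exp (- b * t powr \<alpha>)"
    proof -
      have "q powr \<alpha> = 2 powr log k q"
        using q k by (simp add: powr_def log_def \<alpha>_def)
      also have "\<dots> \<le> 2 powr real (Suc j)"
        using j(2) by (intro powr_mono) auto
      also have "\<dots> = 2 * 2 ^ j" by (subst powr_realpow) auto
      finally show ?thesis using bt[OF that] by (simp add: q_def)
    qed
    finally have "\<eta> t \<le> (1 / C) * exp (- b * t powr \<alpha>)"
      using C by (simp add: field_simps)
    also have "\<dots> \<le> a * exp (- b * t powr \<alpha>)"
      using pos[of 0] by (intro mult_right_mono) (simp_all add: a_def)
    finally show ?thesis .
  qed
  moreover have "a > 0" "b > 0"
    using C pos[of 0] t0 by (auto simp: a_def b_def intro: add_pos_pos)
  ultimately show ?thesis using \<alpha> by blast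
qed

end

section \<open>Rapid decrease and necessity of the growth condition\<close>

locale rapidly_decreasing_weight = radial_weight +
  assumes rapid: "\<And>j::nat. ((\<lambda>t. t ^ j * \<eta> t) \<longlongrightarrow> 0) at_top"
begin

lemma power_times_weight_bounded: "\<exists>B. \<forall>t\<ge>0. t ^ j * \<eta> t \<le> B"
proof -
  have "\<forall>\<^sub>F t in at_top. t ^ j * \<eta> t < 1"
    by (rule order_tendstoD(2)[OF rapid]) simp
  then obtain T where T: "\<And>t. t \<ge> T \<Longrightarrow> t ^ j * \<eta> t < 1"
    by (auto simp: eventually_at_top_linorder)
  \<comment> \<open>From \<open>T\<close> on the limit gives the bound, before it monotonicity does.
    The absolute value covers a negative \<open>T\<close>.\<close>
  have "t ^ j * \<eta> t \<le> max 1 (\<bar>T\<bar> ^ j * \<eta> 0)" if "t \<ge> 0" for t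
  proof (cases "t \<ge> T")
    case True
    with T[of t] show ?thesis by simp
  next
    case False
    have "t ^ j * \<eta> t \<le> \<bar>T\<bar> ^ j * \<eta> 0"
      using False that pos[OF that] mono[of 0 t] by (intro mult_mono power_mono) auto
    then show ?thesis by simp
  qed
  then show ?thesis by blast
qed

text \<open>A member of \<open>unit_ball\<close> is controlled against \<open>\<eta>\<close> alone,
  whereas the space tests against all its larger dilates. Polynomials pass every test: for
  \<open>t = norm x / n\<close>, the power \<open>norm x ^ j\<close> is
  \<open>n ^ j * t ^ j\<close>.\<close>

lemma polynomial_functional_in_weighted_space:
  fixes \<phi> :: "'a::complex_normed_vector \<Rightarrow> complex"
  assumes \<phi>: "bounded_linear \<phi>" "\<And>c x. \<phi> (c *\<^sub>C x) = c * \<phi> x" "\<And>x. cmod (\<phi> x) \<le> norm x"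
  shows "(\<lambda>x. \<Sum>j<N. a j * \<phi> x ^ j) \<in> weighted_space (dilation_weights \<eta>)"
proof (rule weighted_spaceI)
  show "entire (\<lambda>x. \<Sum>j<N. a j * \<phi> x ^ j)"
    using \<phi>(1,2) by (rule entire_holomorphic_compose[rotated]) (intro holomorphic_intros)
next
  fix w :: "'a \<Rightarrow> real" assume "w \<in> dilation_weights \<eta>"
  then obtain n where w: "w = (\<lambda>x. \<eta> (norm x / real n))" and n: "n \<ge> 1"
    by (auto simp: dilation_weights_def)
  obtain B where B: "\<And>j t. t \<ge> 0 \<Longrightarrow> t ^ j * \<eta> t \<le> B j"
    using power_times_weight_bounded by metis
  have "w x * cmod (\<Sum>j<N. a j * \<phi> x ^ j) \<le> (\<Sum>j<N. cmod (a j) * real n ^ j * B j)" for x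
  proof -
    define t where "t = norm x / n"
    have t: "t \<ge> 0" "norm x = n * t" using n by (auto simp: t_def)
    have "cmod (\<Sum>j<N. a j * \<phi> x ^ j) \<le> (\<Sum>j<N. cmod (a j) * norm x ^ j)"
      by (rule sum_norm_le) (simp add: norm_mult norm_power mult_left_mono power_mono \<phi>(3))
    then have "w x * cmod (\<Sum>j<N. a j * \<phi> x ^ j) \<le> \<eta> t * (\<Sum>j<N. cmod (a j) * norm x ^ j)"
      using pos[OF t(1)] by (simp add: w t_def mult_left_mono)
    also have "\<dots> = (\<Sum>j<N. (cmod (a j) * real n ^ j) * (t ^ j * \<eta> t))"
      unfolding t(2) sum_distrib_left by (simp add: power_mult_distrib mult_ac)
    also have "\<dots> \<le> (\<Sum>j<N. cmod (a j) * real n ^ j * B j)"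
      by (intro sum_mono mult_left_mono B t) simp
    finally show ?thesis .
  qed
  then show "\<exists>B. \<forall>x. w x * cmod (\<Sum>j<N. a j * \<phi> x ^ j) \<le> B" by blast
qed

text \<open>The square of a test function of norm at most 1 stays below \<open>C\<close> against
  \<open>w 1\<close>; read at a point of norm \<open>2 * m * t\<close>, this gives the claim with
  \<open>k = 2 * m\<close> and constant \<open>4 * C\<close>.\<close>

lemma dilation_weights_algebraD:
  fixes W :: "('a::complex_normed_vector \<Rightarrow> real) set"
  defines "W \<equiv> dilation_weights \<eta>"
  assumes algebra: "weighted_space_is_algebra W" and nontrivial: "\<exists>x::'a. x \<noteq> 0"
  shows "\<exists>k>1. \<exists>C>0. \<forall>t\<ge>0. \<eta> (k * t) \<le> C * (associated_weight \<eta> t)\<^sup>2"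
proof -
  obtain y :: 'a where "y \<noteq> 0" using nontrivial by blast
  define e where "e = sgn y"
  have e: "norm e = 1" using \<open>y \<noteq> 0\<close> by (simp add: e_def norm_sgn)
  obtain \<phi> where \<phi>: "bounded_linear \<phi>" "\<And>c x. \<phi> (c *\<^sub>C x) = c * \<phi> x"
    "\<And>x::'a. cmod (\<phi> x) \<le> norm x" "\<phi> e = complex_of_real (norm e)"
    using norming_functional[of e] by blast
  define w :: "nat \<Rightarrow> 'a \<Rightarrow> real" where "w n = (\<lambda>x. \<eta> (norm x / real n))" for n
  have W_eq: "W = w ` {1..}"
    by (auto simp: W_def dilation_weights_def w_def)
  obtain m1 m2 C where m12: "m1 \<ge> 1" "m2 \<ge> 1" and C: "C > 0"
    and mult: "\<And>f g. f \<in> weighted_space W \<Longrightarrow> g \<in> weighted_space W \<Longrightarrow>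
      (\<lambda>x. f x * g x) \<in> weighted_space W \<and>
      weighted_norm (w 1) (\<lambda>x. f x * g x) \<le> C * weighted_norm (w m1) f * weighted_norm (w m2) g"
  proof -
    have "w 1 \<in> W" by (simp add: W_eq)
    then have "\<exists>u1\<in>W. \<exists>u2\<in>W. \<exists>C>0. \<forall>f\<in>weighted_space W. \<forall>g\<in>weighted_space W.
        weighted_norm (w 1) (\<lambda>x. f x * g x) \<le> C * weighted_norm u1 f * weighted_norm u2 g"
      by (rule algebra[unfolded weighted_space_is_algebra_def, THEN conjunct2, THEN bspec])
    then obtain u1 u2 C where u: "u1 \<in> W" "u2 \<in> W" and "C > 0"
      and le: "\<forall>f\<in>weighted_space W. \<forall>g\<in>weighted_space W.
        weighted_norm (w 1) (\<lambda>x. f x * g x) \<le> C * weighted_norm u1 f * weighted_norm u2 g"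
      by (elim bexE exE conjE)
    obtain m1 m2 where m: "u1 = w m1" "m1 \<ge> 1" "u2 = w m2" "m2 \<ge> 1"
      using u by (auto simp: W_eq)
    have "(\<lambda>x. f x * g x) \<in> weighted_space W"
      if "f \<in> weighted_space W" "g \<in> weighted_space W" for f g
      using algebra that by (simp add: weighted_space_is_algebra_def)
    with le show thesis
      by (intro that[OF m(2,4) \<open>C > 0\<close>]) (simp add: m)
  qed
  define m where "m = max m1 m2"
  have "\<eta> (2 * m * t) \<le> (4 * C) * (associated_weight \<eta> t)\<^sup>2" if t: "t \<ge> 0" for t :: real
  proof -
    have p: "\<eta> (2 * m * t) > 0" using t by (intro pos) simp
    have "cmod (g (complex_of_real t)) \<le> sqrt (4 * C / \<eta> (2 * m * t))" if g: "g \<in> unit_ball" for g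
    proof -
      define a where "a j = (deriv ^^ j) g 0 / fact j" for j
      define T where "T N z = (\<Sum>j<N. a j * z ^ j)" for N and z :: complex
      have "\<eta> (2 * m * t) * (cmod (T N t))\<^sup>2 \<le> 4 * C" for N
      proof -
        \<comment> \<open>Here \<open>m\<close> matches the larger of the two dilations, the 2
          beside it makes truncation harmless, and the outer 1/2 cancels the 2 in
          \<open>taylor_polynomial_bound\<close>.\<close>
        define f where "f x = T N (\<phi> x / (2 * m)) / 2" for x
        have f_eq: "f = (\<lambda>x. \<Sum>j<N. (a j / (2 * (2 * m) ^ j)) * \<phi> x ^ j)"
          by (rule ext) (simp add: f_def T_def sum_divide_distrib power_divide mult_ac)
        have f: "f \<in> weighted_space W"
          unfolding f_eq W_def
          by (rule polynomial_functional_in_weighted_space) (use \<phi> in auto)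
        have le1: "w n x * cmod (f x) \<le> 1" if n: "n \<ge> 1" "n \<le> m" for n x
        proof -
          have "cmod (f x) \<le> 1 / \<eta> (cmod (\<phi> x / m))"
            using taylor_polynomial_bound[OF g, where N = N and z = "\<phi> x / of_nat m"]
            by (simp add: f_def T_def a_def norm_divide mult.commute)
          also have "\<dots> \<le> 1 / \<eta> (norm x / n)"
          proof (rule inverse_mono)
            show "cmod (\<phi> x / m) \<le> norm x / n"
              using n \<phi>(3)[of x] by (simp add: norm_divide frac_le)
          qed simp
          finally show ?thesis
            using pos[of "norm x / n"] by (simp add: w_def field_simps)
        qed
        have nn: "0 \<le> weighted_norm (w n) f" if "n \<ge> 1" for n
          using order_trans[OF _ weighted_norm_upper[OF f, of "w n" 0]] that pos[of 0]
          by (simp add: W_eq w_def)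
        \<comment> \<open>At this point \<open>\<phi> x / (2 * m)\<close> equals \<open>t\<close>,
          so \<open>f x\<close> is half the Taylor polynomial at \<open>t\<close>.\<close>
        define x where "x = (2 * m * t) *\<^sub>R e"
        have "\<phi> x = complex_of_real (2 * m * t)"
          using \<phi>(2)[of "complex_of_real (2 * m * t)" e] \<phi>(4) e
          by (simp only: x_def scaleC_of_real) simp
        then have fx: "f x = T N t / 2"
          using m12 by (simp add: f_def m_def)
        have w1: "w 1 x = \<eta> (2 * m * t)"
          using t e by (simp add: w_def x_def)
        have "w 1 x * cmod (f x * f x) \<le> weighted_norm (w 1) (\<lambda>x. f x * f x)"
          using mult[OF f f] by (intro weighted_norm_upper[where V = W]) (auto simp: W_eq)
        also have "\<dots> \<le> C * weighted_norm (w m1) f * weighted_norm (w m2) f"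
          using mult[OF f f] by blast
        also have "\<dots> \<le> C * 1 * 1"
          using C m12 by (intro mult_mono weighted_norm_least le1 nn mult_nonneg_nonneg) (auto simp: m_def)
        finally show ?thesis
          unfolding w1 by (simp add: fx norm_mult norm_divide power2_eq_square mult.commute)
      qed
      \<comment> \<open>The bound \<open>4 * C\<close> depends neither on \<open>N\<close> nor on
        \<open>g\<close>: it passes to the limit \<open>g t\<close>, and then to the supremum over
        \<open>unit_ball\<close>.\<close>
      moreover have "(\<lambda>N. T N t) \<longlonglongrightarrow> g t"
        using holomorphic_power_series[of g 0 "t + 1" "complex_of_real t"]
          holomorphic_on_subset[OF unit_ballD(1)[OF g]] t
        by (auto simp: sums_def T_def a_def)
      then have "(\<lambda>N. \<eta> (2 * m * t) * (cmod (T N t))\<^sup>2) \<longlonglongrightarrow> \<eta> (2 * m * t) * (cmod (g t))\<^sup>2"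
        by (intro tendsto_intros)
      ultimately have "\<eta> (2 * m * t) * (cmod (g t))\<^sup>2 \<le> 4 * C"
        by (intro LIMSEQ_le_const2) auto
      then show ?thesis
        using p by (intro real_le_rsqrt) (simp add: field_simps)
    qed
    then have "1 / associated_weight \<eta> t \<le> sqrt (4 * C / \<eta> (2 * m * t))"
      by (rule inverse_associated_weight_least)
    then have "(1 / associated_weight \<eta> t)\<^sup>2 \<le> 4 * C / \<eta> (2 * m * t)"
      using associated_weight_pos[OF t] C p power_mono[of "1 / associated_weight \<eta> t" _ 2] by fastforce
    then show ?thesis
      using associated_weight_pos[OF t] p by (simp add: field_simps power_divide)
  qed
  moreover have "real (2 * m) > 1" using m12 by (simp add: m_def)
  ultimately show ?thesis
    using C by (intro exI[of _ "2 * real m"] conjI exI[of _ "4 * C"]) auto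
qed

end

section \<open>Both algebra criteria, the embedding and the decay\<close>

theorem proposition2p4:
  fixes \<eta> :: "real \<Rightarrow> real"
    and V W :: "('a::complex_banach \<Rightarrow> real) set"
  assumes nontrivial: "\<exists>x::'a. x \<noteq> 0"
    and pos: "\<forall>t\<ge>0. \<eta> t > 0"
    and decreasing: "antimono_on {0..} \<eta>"
    and cont: "continuous_on {0..} \<eta>"
    and rapid: "\<forall>k::nat. ((\<lambda>t. t ^ k * \<eta> t) \<longlongrightarrow> 0) at_top"
    and V: "V = power_weights \<eta>"
    and W: "W = dilation_weights \<eta>"
  shows "(weighted_space_is_algebra W \<longleftrightarrow>
           (\<exists>k>1. \<exists>C>0. \<forall>t\<ge>0. \<eta> (k * t) \<le> C * (associated_weight \<eta> t)\<^sup>2)) \<and>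
         (essential \<eta> \<longrightarrow>
           (weighted_space_is_algebra W \<longleftrightarrow>
             (\<exists>k>1. \<exists>C>0. \<forall>t\<ge>0. \<eta> (k * t) \<le> C * (\<eta> t)\<^sup>2)) \<and>
           (weighted_space_is_algebra W \<longrightarrow>
             continuous_map (weighted_topology W) (weighted_topology V) (\<lambda>f. f) \<and>
             (\<exists>a>0. \<exists>b>0. \<exists>\<alpha>>0. \<forall>t\<ge>0. \<eta> t \<le> a * exp (- b * t powr \<alpha>))))"
proof -
  interpret rapidly_decreasing_weight \<eta>
    using pos decreasing rapid by unfold_locales auto
  have algebra_iff: "weighted_space_is_algebra W \<longleftrightarrow>
      (\<exists>k>1. \<exists>C>0. \<forall>t\<ge>0. \<eta> (k * t) \<le> C * (associated_weight \<eta> t)\<^sup>2)"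
    (is "_ \<longleftrightarrow> ?assoc")
  proof
    show ?assoc if "weighted_space_is_algebra W"
      using dilation_weights_algebraD that nontrivial unfolding W by blast
    assume ?assoc
    then obtain k C where "k > 1" "C > 0"
      "\<And>t. t \<ge> 0 \<Longrightarrow> \<eta> (k * t) \<le> C * (associated_weight \<eta> t)\<^sup>2"
      by blast
    then show "weighted_space_is_algebra W"
      unfolding W by (intro dilation_weights_algebraI[of k C]) auto
  qed
  moreover have "(weighted_space_is_algebra W \<longleftrightarrow>
      (\<exists>k>1. \<exists>C>0. \<forall>t\<ge>0. \<eta> (k * t) \<le> C * (\<eta> t)\<^sup>2)) \<and>
    (weighted_space_is_algebra W \<longrightarrow>
      continuous_map (weighted_topology W) (weighted_topology V) (\<lambda>f. f) \<and>
      (\<exists>a>0. \<exists>b>0. \<exists>\<alpha>>0. \<forall>t\<ge>0. \<eta> t \<le> a * exp (- b * t powr \<alpha>)))"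
    (is "(_ \<longleftrightarrow> ?doubling) \<and> (_ \<longrightarrow> ?incl \<and> ?decay)") if essential: "essential \<eta>"
  proof -
    obtain D where D: "\<And>t. t \<ge> 0 \<Longrightarrow> associated_weight \<eta> t \<le> D * \<eta> t"
      using essential by (auto simp: essential_def)
    \<comment> \<open>\<open>essential\<close> fixes no sign for its constant; positivity of the
      associated weight at 0 forces it.\<close>
    have "0 < D * \<eta> 0"
      using D[of 0] associated_weight_pos[of 0] by linarith
    then have D0: "D > 0" using pos[of 0] by (simp add: zero_less_mult_iff)
    \<comment> \<open>Since \<open>\<eta> \<le> associated_weight \<eta> \<le> D * \<eta>\<close> on
      the half-line, exchanging the two weights costs at most a factor
      \<open>D\<^sup>2\<close>.\<close>
    have "?assoc \<longleftrightarrow> ?doubling"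
    proof
      assume ?assoc
      then obtain k C where kC: "k > 1" "C > 0"
        "\<And>t. t \<ge> 0 \<Longrightarrow> \<eta> (k * t) \<le> C * (associated_weight \<eta> t)\<^sup>2"
        by blast
      have "\<eta> (k * t) \<le> (C * D\<^sup>2) * (\<eta> t)\<^sup>2" if "t \<ge> 0" for t
      proof -
        have "(associated_weight \<eta> t)\<^sup>2 \<le> (D * \<eta> t)\<^sup>2"
          using D[OF that] associated_weight_pos[OF that] by (intro power_mono) auto
        then have "C * (associated_weight \<eta> t)\<^sup>2 \<le> C * (D * \<eta> t)\<^sup>2"
          using kC(2) by simp
        with kC(3)[OF that] show ?thesis by (simp add: power_mult_distrib mult.assoc)
      qed
      with kC D0 show ?doubling by (intro exI[of _ k] conjI exI[of _ "C * D\<^sup>2"]) auto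
    next
      assume ?doubling
      then obtain k C where kC: "k > 1" "C > 0"
        "\<And>t. t \<ge> 0 \<Longrightarrow> \<eta> (k * t) \<le> C * (\<eta> t)\<^sup>2"
        by blast
      have "\<eta> (k * t) \<le> C * (associated_weight \<eta> t)\<^sup>2" if "t \<ge> 0" for t
      proof -
        have "(\<eta> t)\<^sup>2 \<le> (associated_weight \<eta> t)\<^sup>2"
          using weight_le_associated_weight[OF that] pos that by (intro power_mono) (auto intro: less_imp_le)
        then have "C * (\<eta> t)\<^sup>2 \<le> C * (associated_weight \<eta> t)\<^sup>2"
          using kC(2) by simp
        with kC(3)[OF that] show ?thesis by simp
      qed
      with kC show ?assoc by blast
    qed
    with algebra_iff have iff: "weighted_space_is_algebra W \<longleftrightarrow> ?doubling"
      by simp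
    moreover have "?incl \<and> ?decay" if doubling: ?doubling
    proof
      obtain k C where kC: "k > 1" "C > 0" "\<And>t. t \<ge> 0 \<Longrightarrow> \<eta> (k * t) \<le> C * (\<eta> t)\<^sup>2"
        using doubling by blast
      show ?incl
      proof (rule weighted_inclusion_continuous)
        show "V \<noteq> {}" by (auto simp: V power_weights_def)
        show "v x \<ge> 0" if "v \<in> V" for v x
          using that by (auto simp: V power_weights_def)
        show "w x \<ge> 0" if "w \<in> W" for w x
        proof -
          obtain n where "w = (\<lambda>x. \<eta> (norm x / real n))"
            using \<open>w \<in> W\<close> unfolding W dilation_weights_def by blast
          then show ?thesis using pos[of "norm x / real n"] by simp
        qed
        fix v assume "v \<in> V"
        then obtain n where v: "v = (\<lambda>x. \<eta> (norm x) powr (1 / real n))" "n \<ge> 1"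
          by (auto simp: V power_weights_def)
        obtain m B where m: "m \<ge> 1" "B > 0" "\<forall>t\<ge>0. \<eta> t powr (1 / n) \<le> B * \<eta> (t / real m)"
          using power_weight_dominated[OF less_imp_le[OF kC(1)] kC(2,3) v(2)] by blast
        then show "\<exists>w\<in>W. \<exists>C>0. \<forall>x. v x \<le> C * w x"
          by (intro bexI[of _ "\<lambda>x. \<eta> (norm x / real m)"] exI[of _ B])
            (auto simp: v W dilation_weights_def)
      qed
      \<comment> \<open>Exponent 0 in \<open>rapid\<close> says that \<open>\<eta>\<close> tends to
        0, which provides the start of the iteration.\<close>
      show ?decay
        using exponential_decay[OF kC] rapid[rule_format, of 0] by simp
    qed
    ultimately show ?thesis by blast
  qed
  ultimately show ?thesis by blast
qed

end
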